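(* Consider the TV-ARMA($p,q$) equation with deterministic coefficients $y_t=\varphi(t)+\sum_{m=1}^{p}\phi_m(t)y_{t-m}+\varepsilon_t+\sum_{l=1}^{q}\theta_l(t)\varepsilon_{t-l}$, $t\in\mathbb{Z}$. Suppose $\sum_{r=-\infty}^{t}|\xi(t,r)|<\infty$ for all $t$, and that $\varphi(t)$ and $\theta_l(t)$ ($1\le l\le q$) are bounded functions of $t$. Let $y_t=\sum_{r=-\infty}^{t}\xi(t,r)\varphi(r)+\sum_{r=-\infty}^{t}\xi_q(t,r)\varepsilon_r$. Then for every integer $\ell\ge 0$ the time-varying $\ell$-order autocovariance function $\gamma_t(\ell)=\operatorname{Cov}(y_t,y_{t-\ell})$ exists in $\mathbb{R}$ and is given by $$\gamma_t(\ell)=\sum_{r=-\infty}^{t-\ell}\xi_q(t,r)\,\xi_q(t-\ell,r)\,\sigma^2(r).$$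
   Context: Let $p,q\ge 1$ be integers. The coefficients $\varphi(t),\phi_m(t),\theta_l(t)$ are deterministic real-valued functions of $t\in\mathbb{Z}$. The errors satisfy $\mathbb{E}(\varepsilon_t)=0$, $\mathbb{E}(\varepsilon_t\varepsilon_s)=0$ for $s\ne t$, $\mathbb{E}(\varepsilon_t\mid y_s,s<t)=0$, $\mathbb{E}(\varepsilon_t^2)=\sigma^2(t)$ with $0<\sigma^2(t)\le M<\infty$ for all $t$ and some $M$. Infinite sums of random variables are understood as limits in $L_2=L_2(\Omega,\mathcal F,P)$. Principal determinant: for integers $s<t$, $\xi(t,s)=\det(\mathbf{\Phi}_{t,s})$, where $\mathbf{\Phi}_{t,s}$ is the $(t-s)\times(t-s)$ matrix whose $(i,j)$ entry is $\phi_{i-j+1}(s+i)$ if $0\le i-j\le p-1$, $-1$ if $j=i+1$, and $0$ otherwise. Moreover $\xi(t,t)=1$ and $\xi(t,s)=0$ for $t<s$. Also $\xi_q(t,r)=\xi(t,r)+\sum_{l=1}^{q}\xi(t,r+l)\theta_l(r+l)$. *)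

theory Defs
  imports "HOL-Probability.Probability" "Jordan_Normal_Form.Determinant"
begin

section \<open>Principal determinants\<close>

text \<open>Matrices have 0-based indices here, so position (i, j) holds the (i+1, j+1) entry of the
  1-based description; the difference i - j is not affected by the shift, and the argument
  of the coefficient becomes s + i + 1.\<close>

definition principal_matrix ::
  "nat \<Rightarrow> (nat \<Rightarrow> int \<Rightarrow> real) \<Rightarrow> int \<Rightarrow> int \<Rightarrow> real Matrix.mat" where
  "principal_matrix p \<phi> t s =
     Matrix.mat (nat (t - s)) (nat (t - s))
       (\<lambda>(i, j). if j \<le> i \<and> i - j \<le> p - 1 then \<phi> (i - j + 1) (s + int i + 1)
                else if j = i + 1 then - 1
                else 0)"

definition principal_det :: "nat \<Rightarrow> (nat \<Rightarrow> int \<Rightarrow> real) \<Rightarrow> int \<Rightarrow> int \<Rightarrow> real" where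
  "principal_det p \<phi> t s =
     (if s < t then Determinant.det (principal_matrix p \<phi> t s)
      else if s = t then 1
      else 0)"

definition principal_det_ma ::
  "nat \<Rightarrow> nat \<Rightarrow> (nat \<Rightarrow> int \<Rightarrow> real) \<Rightarrow> (nat \<Rightarrow> int \<Rightarrow> real) \<Rightarrow> int \<Rightarrow> int \<Rightarrow> real" where
  "principal_det_ma p q \<phi> \<theta> t r =
     principal_det p \<phi> t r
       + (\<Sum>l = 1..q. principal_det p \<phi> t (r + int l) * \<theta> l (r + int l))"


section \<open>Square-integrable random variables and sums in \<open>L\<^sub>2\<close>\<close>

definition square_integrable :: "'a measure \<Rightarrow> ('a \<Rightarrow> real) \<Rightarrow> bool" where
  "square_integrable M X \<longleftrightarrow> X \<in> borel_measurable M \<and> integrable M (\<lambda>\<omega>. (X \<omega>)\<^sup>2)"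

definition L2_tendsto ::
  "'a measure \<Rightarrow> ('i \<Rightarrow> 'a \<Rightarrow> real) \<Rightarrow> ('a \<Rightarrow> real) \<Rightarrow> 'i filter \<Rightarrow> bool" where
  "L2_tendsto M X Y F \<longleftrightarrow>
     (\<forall>\<^sub>F i in F. square_integrable M (X i)) \<and> square_integrable M Y \<and>
     ((\<lambda>i. \<integral>\<omega>. (X i \<omega> - Y \<omega>)\<^sup>2 \<partial>M) \<longlongrightarrow> 0) F"

text \<open>The sum over all integers r \<open>\<le>\<close> t is the limit of the partial sums over s, \<open>\<dots>\<close>, t
  as s tends to minus infinity.\<close>

definition has_L2_sum :: "'a measure \<Rightarrow> (int \<Rightarrow> 'a \<Rightarrow> real) \<Rightarrow> int \<Rightarrow> ('a \<Rightarrow> real) \<Rightarrow> bool" where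
  "has_L2_sum M f t Y \<longleftrightarrow> L2_tendsto M (\<lambda>s \<omega>. \<Sum>r = s..t. f r \<omega>) Y at_bot"

definition L2_summable :: "'a measure \<Rightarrow> (int \<Rightarrow> 'a \<Rightarrow> real) \<Rightarrow> int \<Rightarrow> bool" where
  "L2_summable M f t \<longleftrightarrow> (\<exists>Y. has_L2_sum M f t Y)"

text \<open>Some version of the sum, which is determined up to almost sure equality if it exists;
  unspecified if it does not exist.\<close>

definition L2_sum :: "'a measure \<Rightarrow> (int \<Rightarrow> 'a \<Rightarrow> real) \<Rightarrow> int \<Rightarrow> 'a \<Rightarrow> real" where
  "L2_sum M f t = (SOME Y. has_L2_sum M f t Y)"


section \<open>Covariance and past of a process\<close>

definition has_covariance ::
  "'a measure \<Rightarrow> ('a \<Rightarrow> real) \<Rightarrow> ('a \<Rightarrow> real) \<Rightarrow> real \<Rightarrow> bool" where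
  "has_covariance M X Y c \<longleftrightarrow>
     integrable M X \<and> integrable M Y \<and>
     has_bochner_integral M
       (\<lambda>\<omega>. (X \<omega> - integral\<^sup>L M X) * (Y \<omega> - integral\<^sup>L M Y)) c"

definition strict_past :: "'a measure \<Rightarrow> (int \<Rightarrow> 'a \<Rightarrow> real) \<Rightarrow> int \<Rightarrow> 'a measure" where
  "strict_past M y t =
     sigma (space M) {y s -` B \<inter> space M |s B. s < t \<and> B \<in> sets borel}"

end

theory Submission
  imports Defs
begin

text \<open>
  Boundedness of the \<open>\<theta>\<close>s makes \<open>r \<mapsto> \<xi>\<^sub>q(t, r)\<close> absolutely summable. A series \<open>\<Sum>a\<^sub>k e\<^sub>k\<close> with absolutely
  summable weights and \<open>E e\<^sub>k\<^sup>2 \<le> B\<close> converges almost surely, and the weighted Cauchy--Schwarz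
  inequality \<open>(\<Sum>a\<^sub>k e\<^sub>k)\<^sup>2 \<le> (\<Sum>|a\<^sub>k|) (\<Sum>|a\<^sub>k| e\<^sub>k\<^sup>2)\<close>, applied to the tails, shows that it also converges
  in \<open>L\<^sub>2\<close>. This yields the stochastic part of \<open>y\<^sub>t\<close> without completeness of \<open>L\<^sub>2\<close>. Since the inner
  product is continuous in \<open>L\<^sub>2\<close>, the covariance is the limit of the covariances of the partial sums,
  which orthogonality of the errors reduces to diagonal sums.
\<close>

section \<open>Weighted series of real numbers and almost everywhere summability\<close>

lemma suminf_weighted_Cauchy_Schwarz:
  fixes a e :: "nat \<Rightarrow> real"
  assumes a: "summable (\<lambda>n. \<bar>a n\<bar>)" and ae: "summable (\<lambda>n. \<bar>a n\<bar> * (e n)\<^sup>2)"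
  shows "summable (\<lambda>n. a n * e n)"
    and "(\<Sum>n. a n * e n)\<^sup>2 \<le> (\<Sum>n. \<bar>a n\<bar>) * (\<Sum>n. \<bar>a n\<bar> * (e n)\<^sup>2)"
proof -
  \<comment> \<open>The terms are dominated by a sum of two summable ones, since
    \<open>2 * |e n| <= 1 + (e n)^2\<close>.\<close>
  have bound: "\<bar>a n * e n\<bar> \<le> \<bar>a n\<bar> + \<bar>a n\<bar> * (e n)\<^sup>2" for n
  proof -
    have "0 \<le> (\<bar>e n\<bar> - 1)\<^sup>2"
      by simp
    then have "\<bar>e n\<bar> \<le> 1 + (e n)\<^sup>2"
      by (simp add: power2_diff)
    from mult_left_mono[OF this, of "\<bar>a n\<bar>"] show ?thesis
      by (simp add: abs_mult algebra_simps)
  qed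
  show s: "summable (\<lambda>n. a n * e n)"
    by (rule summable_comparison_test'[OF summable_add[OF a ae], of 0]) (use bound in auto)
  have "(\<Sum>n<k. a n * e n)\<^sup>2 \<le> (\<Sum>n<k. \<bar>a n\<bar>) * (\<Sum>n<k. \<bar>a n\<bar> * (e n)\<^sup>2)" for k
  proof -
    \<comment> \<open>Each weight is split as \<open>|a n| = sqrt |a n| * sqrt |a n|\<close>. The
      sign of \<open>a n\<close> goes into the second factor, where squaring removes it.\<close>
    have "(\<Sum>n<k. a n * e n) = (\<Sum>n<k. sqrt \<bar>a n\<bar> * (sgn (a n) * sqrt \<bar>a n\<bar> * e n))"
      by (intro sum.cong) (auto simp: algebra_simps sgn_if simp flip: real_sqrt_mult)
    also have "\<dots>\<^sup>2 \<le> (\<Sum>n<k. (sqrt \<bar>a n\<bar>)\<^sup>2) * (\<Sum>n<k. (sgn (a n) * sqrt \<bar>a n\<bar> * e n)\<^sup>2)"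
      by (rule Cauchy_Schwarz_ineq_sum)
    also have "\<dots> = (\<Sum>n<k. \<bar>a n\<bar>) * (\<Sum>n<k. \<bar>a n\<bar> * (e n)\<^sup>2)"
      by (intro arg_cong2[where f = "(*)"] sum.cong) (auto simp: power_mult_distrib sgn_if)
    finally show ?thesis .
  qed
  then show "(\<Sum>n. a n * e n)\<^sup>2 \<le> (\<Sum>n. \<bar>a n\<bar>) * (\<Sum>n. \<bar>a n\<bar> * (e n)\<^sup>2)"
    by (intro LIMSEQ_le[OF tendsto_power[OF summable_LIMSEQ[OF s]]
          tendsto_mult[OF summable_LIMSEQ[OF a] summable_LIMSEQ[OF ae]]]) auto
qed

text \<open>Sum and integral may be interchanged for nonnegative functions in
  \<open>ennreal\<close>. The pointwise sum thus has a finite integral, so it is finite almost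
  everywhere.\<close>

lemma AE_summable_if_summable_integrals:
  fixes f :: "nat \<Rightarrow> 'a \<Rightarrow> real"
  assumes int: "\<And>n. integrable M (f n)" and nonneg: "\<And>n x. 0 \<le> f n x"
    and sums: "summable (\<lambda>n. \<integral>x. f n x \<partial>M)"
  shows "AE x in M. summable (\<lambda>n. f n x)"
proof -
  have [measurable]: "f n \<in> borel_measurable M" for n
    using int by auto
  have "(\<integral>\<^sup>+x. (\<Sum>n. ennreal (f n x)) \<partial>M) = (\<Sum>n. ennreal (\<integral>x. f n x \<partial>M))"
    by (subst nn_integral_suminf)
       (auto intro!: suminf_cong nn_integral_eq_integral int simp: nonneg)
  also have "\<dots> = ennreal (\<Sum>n. \<integral>x. f n x \<partial>M)"
    using sums nonneg by (intro suminf_ennreal2) auto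
  finally have "(\<integral>\<^sup>+x. (\<Sum>n. ennreal (f n x)) \<partial>M) \<noteq> \<infinity>"
    by simp
  from nn_integral_PInf_AE[OF _ this] have "AE x in M. (\<Sum>n. ennreal (f n x)) \<noteq> \<infinity>"
    by simp
  then show ?thesis
    by eventually_elim (auto intro!: summable_suminf_not_top nonneg)
qed

section \<open>Square-integrable functions and continuity of the inner product\<close>

lemma square_integrable_mult:
  assumes "square_integrable M X" "square_integrable M Y"
  shows "integrable M (\<lambda>\<omega>. X \<omega> * Y \<omega>)"
proof (rule Bochner_Integration.integrable_bound)
  show "integrable M (\<lambda>\<omega>. (X \<omega>)\<^sup>2 + (Y \<omega>)\<^sup>2)"
    using assms by (auto simp: square_integrable_def)
  show "(\<lambda>\<omega>. X \<omega> * Y \<omega>) \<in> borel_measurable M"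
    using assms by (auto simp: square_integrable_def)
  have "\<bar>x * y\<bar> \<le> x\<^sup>2 + y\<^sup>2" for x y :: real
  proof -
    have "0 \<le> (\<bar>x\<bar> - \<bar>y\<bar>)\<^sup>2" "0 \<le> \<bar>x\<bar> * \<bar>y\<bar>"
      by simp_all
    then show ?thesis
      by (simp only: power2_diff power2_abs abs_mult)
  qed
  then show "AE \<omega> in M. norm (X \<omega> * Y \<omega>) \<le> norm ((X \<omega>)\<^sup>2 + (Y \<omega>)\<^sup>2)"
    by (auto simp: abs_mult)
qed

lemma square_integrable_scale:
  "square_integrable M X \<Longrightarrow> square_integrable M (\<lambda>\<omega>. c * X \<omega>)"
  by (auto simp: square_integrable_def power_mult_distrib)

lemma square_integrable_add:
  assumes "square_integrable M X" "square_integrable M Y"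
  shows "square_integrable M (\<lambda>\<omega>. X \<omega> + Y \<omega>)"
  using assms square_integrable_mult[OF assms]
  by (auto simp: square_integrable_def power2_sum mult.assoc)

lemma square_integrable_diff:
  assumes "square_integrable M X" "square_integrable M Y"
  shows "square_integrable M (\<lambda>\<omega>. X \<omega> - Y \<omega>)"
  using square_integrable_add[OF assms(1) square_integrable_scale[OF assms(2), of "-1"]]
  by simp

lemma square_integrable_sum:
  assumes "\<And>i. i \<in> I \<Longrightarrow> square_integrable M (X i)"
  shows "square_integrable M (\<lambda>\<omega>. \<Sum>i\<in>I. X i \<omega>)"
  using assms
\<comment> \<open>A sum over an infinite index set is 0 by convention, so that case is closed
  together with the empty one.\<close>
proof (induction I rule: infinite_finite_induct)
  case (insert i I)
  then show ?case
    by (simp add: square_integrable_add)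
qed (auto simp: square_integrable_def)

lemma integral_Cauchy_Schwarz:
  assumes X: "square_integrable M X" and Y: "square_integrable M Y"
  shows "(\<integral>\<omega>. X \<omega> * Y \<omega> \<partial>M)\<^sup>2 \<le> (\<integral>\<omega>. (X \<omega>)\<^sup>2 \<partial>M) * (\<integral>\<omega>. (Y \<omega>)\<^sup>2 \<partial>M)"
proof -
  define b where "b = (\<integral>\<omega>. (Y \<omega>)\<^sup>2 \<partial>M)"
  define c where "c = (\<integral>\<omega>. X \<omega> * Y \<omega> \<partial>M)"
  have iX: "integrable M (\<lambda>\<omega>. (X \<omega>)\<^sup>2)" and iY: "integrable M (\<lambda>\<omega>. (Y \<omega>)\<^sup>2)"
    using X Y by (auto simp: square_integrable_def)
  note iXY = square_integrable_mult[OF X Y]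
  show ?thesis
  proof (cases "b = 0")
    case True
    then have "AE \<omega> in M. (Y \<omega>)\<^sup>2 = 0"
      using integral_nonneg_eq_0_iff_AE[OF iY] by (simp add: b_def)
    then have "AE \<omega> in M. X \<omega> * Y \<omega> = 0"
      by eventually_elim simp
    then have "c = 0"
      unfolding c_def by (rule integral_eq_zero_AE)
    then show ?thesis
      by (simp flip: c_def)
  next
    case False
    then have b: "b > 0"
      by (simp add: b_def less_le)
    \<comment> \<open>This \<open>r\<close> minimises the integral of \<open>(X - r * Y)^2\<close>,
      a quadratic polynomial in \<open>r\<close>. Nonnegativity of its minimum is the claim.\<close>
    define r where "r = c / b"
    have "0 \<le> (\<integral>\<omega>. (X \<omega> - r * Y \<omega>)\<^sup>2 \<partial>M)"
      by simp
    also have "\<dots> = (\<integral>\<omega>. (X \<omega>)\<^sup>2 - 2 * r * (X \<omega> * Y \<omega>) + r\<^sup>2 * (Y \<omega>)\<^sup>2 \<partial>M)"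
      by (intro Bochner_Integration.integral_cong)
         (auto simp: power2_diff power_mult_distrib algebra_simps)
    also have "\<dots> = (\<integral>\<omega>. (X \<omega>)\<^sup>2 \<partial>M) - 2 * r * c + r\<^sup>2 * b"
      using iX iY iXY by (simp add: b_def c_def)
    also have "\<dots> = (\<integral>\<omega>. (X \<omega>)\<^sup>2 \<partial>M) - c\<^sup>2 / b"
      using b by (simp add: r_def field_simps power2_eq_square)
    finally show ?thesis
      using b by (simp add: field_simps flip: b_def c_def)
  qed
qed

text \<open>With errors \<open>D = X i - X'\<close> and \<open>E = Y i - Y'\<close>, the product
  \<open>X i * Y i\<close> differs from \<open>X' * Y'\<close> by
  \<open>D * E + X' * E + D * Y'\<close>. Cauchy-Schwarz makes the integral of each of these terms
  small. The lemma later carries both means (with the constant 1 as second factor) and covariances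
  from partial sums to the limits.\<close>

lemma L2_tendsto_integral_mult:
  assumes X: "L2_tendsto M X X' F" and Y: "L2_tendsto M Y Y' F"
  shows "((\<lambda>i. \<integral>\<omega>. X i \<omega> * Y i \<omega> \<partial>M) \<longlongrightarrow> (\<integral>\<omega>. X' \<omega> * Y' \<omega> \<partial>M)) F"
proof -
  define x where "x i = (\<integral>\<omega>. (X i \<omega> - X' \<omega>)\<^sup>2 \<partial>M)" for i
  define y where "y i = (\<integral>\<omega>. (Y i \<omega> - Y' \<omega>)\<^sup>2 \<partial>M)" for i
  define x' where "x' = (\<integral>\<omega>. (X' \<omega>)\<^sup>2 \<partial>M)"
  define y' where "y' = (\<integral>\<omega>. (Y' \<omega>)\<^sup>2 \<partial>M)"
  have X': "square_integrable M X'" and Y': "square_integrable M Y'"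
    and evX: "\<forall>\<^sub>F i in F. square_integrable M (X i)"
    and evY: "\<forall>\<^sub>F i in F. square_integrable M (Y i)"
    and x: "(x \<longlongrightarrow> 0) F" and y: "(y \<longlongrightarrow> 0) F"
    using X Y by (simp_all add: L2_tendsto_def x_def[abs_def] y_def[abs_def])
  have *: "((\<lambda>i. sqrt (x i * y i) + sqrt (x' * y i) + sqrt (x i * y')) \<longlongrightarrow> 0) F"
    using x y by (auto intro!: tendsto_eq_intros)
  have "((\<lambda>i. (\<integral>\<omega>. X i \<omega> * Y i \<omega> \<partial>M) - (\<integral>\<omega>. X' \<omega> * Y' \<omega> \<partial>M)) \<longlongrightarrow> 0) F"
  proof (rule Lim_null_comparison[OF _ *])
    show "\<forall>\<^sub>F i in F. norm ((\<integral>\<omega>. X i \<omega> * Y i \<omega> \<partial>M) - (\<integral>\<omega>. X' \<omega> * Y' \<omega> \<partial>M))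
      \<le> sqrt (x i * y i) + sqrt (x' * y i) + sqrt (x i * y')"
      using evX evY
    proof eventually_elim
      case (elim i)
      define D where "D = (\<lambda>\<omega>. X i \<omega> - X' \<omega>)"
      define E where "E = (\<lambda>\<omega>. Y i \<omega> - Y' \<omega>)"
      have D: "square_integrable M D" and E: "square_integrable M E"
        unfolding D_def E_def using elim X' Y' by (auto intro: square_integrable_diff)
      note int = square_integrable_mult[OF D E] square_integrable_mult[OF X' E]
        square_integrable_mult[OF D Y'] square_integrable_mult[OF X' Y']
      have "(\<integral>\<omega>. X i \<omega> * Y i \<omega> \<partial>M)
          = (\<integral>\<omega>. D \<omega> * E \<omega> + X' \<omega> * E \<omega> + D \<omega> * Y' \<omega> + X' \<omega> * Y' \<omega> \<partial>M)"
        by (intro Bochner_Integration.integral_cong) (auto simp: D_def E_def algebra_simps)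
      also have "\<dots> = (\<integral>\<omega>. D \<omega> * E \<omega> \<partial>M) + (\<integral>\<omega>. X' \<omega> * E \<omega> \<partial>M)
          + (\<integral>\<omega>. D \<omega> * Y' \<omega> \<partial>M) + (\<integral>\<omega>. X' \<omega> * Y' \<omega> \<partial>M)"
        using int by simp
      finally have eq: "(\<integral>\<omega>. X i \<omega> * Y i \<omega> \<partial>M) - (\<integral>\<omega>. X' \<omega> * Y' \<omega> \<partial>M)
          = (\<integral>\<omega>. D \<omega> * E \<omega> \<partial>M) + (\<integral>\<omega>. X' \<omega> * E \<omega> \<partial>M) + (\<integral>\<omega>. D \<omega> * Y' \<omega> \<partial>M)"
        by simp
      have "\<bar>\<integral>\<omega>. D \<omega> * E \<omega> \<partial>M\<bar> \<le> sqrt (x i * y i)"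
        using integral_Cauchy_Schwarz[OF D E]
        by (intro real_le_rsqrt) (simp add: D_def E_def x_def y_def)
      moreover have "\<bar>\<integral>\<omega>. X' \<omega> * E \<omega> \<partial>M\<bar> \<le> sqrt (x' * y i)"
        using integral_Cauchy_Schwarz[OF X' E]
        by (intro real_le_rsqrt) (simp add: E_def x'_def y_def)
      moreover have "\<bar>\<integral>\<omega>. D \<omega> * Y' \<omega> \<partial>M\<bar> \<le> sqrt (x i * y')"
        using integral_Cauchy_Schwarz[OF D Y']
        by (intro real_le_rsqrt) (simp add: D_def x_def y'_def)
      ultimately show ?case
        unfolding eq real_norm_def by linarith
    qed
  qed
  then show ?thesis
    by (simp add: LIM_zero_iff)
qed

section \<open>Mean-square convergence of absolutely weighted series\<close>

text \<open>The limit is written down as a pointwise series, so only its tails have to be estimated.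
  The squared tail from \<open>n\<close> on is at most a deterministic null sequence
  \<open>A n\<close> times one integrable function that does not depend on \<open>n\<close>.\<close>

lemma L2_tendsto_weighted_sum:
  fixes a :: "nat \<Rightarrow> real"
  assumes a: "summable (\<lambda>n. \<bar>a n\<bar>)" and e: "\<And>n. square_integrable M (e n)"
    and B: "\<And>n. (\<integral>\<omega>. (e n \<omega>)\<^sup>2 \<partial>M) \<le> B"
  shows "L2_tendsto M (\<lambda>n \<omega>. \<Sum>k<n. a k * e k \<omega>) (\<lambda>\<omega>. \<Sum>k. a k * e k \<omega>) sequentially"
proof -
  define H where "H n \<omega> = \<bar>a n\<bar> * (e n \<omega>)\<^sup>2" for n \<omega>
  \<comment> \<open>\<open>suminf\<close> has an unspecified value where the series diverges; by
    \<open>AE_H\<close> below this happens only on a null set.\<close>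
  define Y where "Y = (\<lambda>\<omega>. \<Sum>k. a k * e k \<omega>)"
  define A where "A n = (\<Sum>k. \<bar>a (k + n)\<bar>)" for n
  have [measurable]: "e n \<in> borel_measurable M" for n
    using e by (auto simp: square_integrable_def)
  have Y[measurable]: "Y \<in> borel_measurable M"
    unfolding Y_def by measurable
  have H: "integrable M (H n)" for n
    using e[of n] by (simp add: H_def[abs_def] square_integrable_def)
  have H_nonneg: "0 \<le> H n \<omega>" for n \<omega>
    by (simp add: H_def)
  \<comment> \<open>The uniform bound \<open>B\<close> on the second moments reduces this to
    summability of the weights.\<close>
  have sumH: "summable (\<lambda>n. \<integral>\<omega>. H n \<omega> \<partial>M)"
  proof (rule summable_comparison_test')
    show "summable (\<lambda>n. \<bar>a n\<bar> * B)"
      by (rule summable_mult2[OF a])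
    show "norm (\<integral>\<omega>. H n \<omega> \<partial>M) \<le> \<bar>a n\<bar> * B" if "n \<ge> 0" for n
      using mult_left_mono[OF B[of n], of "\<bar>a n\<bar>"] by (simp add: H_def abs_mult)
  qed
  have AE_H: "AE \<omega> in M. summable (\<lambda>n. H n \<omega>)"
    by (rule AE_summable_if_summable_integrals[OF H H_nonneg sumH])
  have int_H: "integrable M (\<lambda>\<omega>. \<Sum>n. H n \<omega>)"
    using AE_H sumH H_nonneg by (intro integrable_suminf H) auto
  have A_nonneg: "A n \<ge> 0" for n
    unfolding A_def using summable_ignore_initial_segment[OF a] by (intro suminf_nonneg) auto
  have tail: "AE \<omega> in M. ((\<Sum>k<n. a k * e k \<omega>) - Y \<omega>)\<^sup>2 \<le> A n * (\<Sum>k. H k \<omega>)" for n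
    using AE_H
  proof eventually_elim
    case (elim \<omega>)
    have "summable (\<lambda>n. a n * e n \<omega>)"
      using elim by (intro suminf_weighted_Cauchy_Schwarz(1)[OF a]) (simp add: H_def)
    then have "(\<Sum>k<n. a k * e k \<omega>) - Y \<omega> = - (\<Sum>k. a (k + n) * e (k + n) \<omega>)"
      using suminf_split_initial_segment[of "\<lambda>k. a k * e k \<omega>" n] by (simp add: Y_def)
    then have "((\<Sum>k<n. a k * e k \<omega>) - Y \<omega>)\<^sup>2 = (\<Sum>k. a (k + n) * e (k + n) \<omega>)\<^sup>2"
      by simp
    also have "\<dots> \<le> (\<Sum>k. \<bar>a (k + n)\<bar>) * (\<Sum>k. \<bar>a (k + n)\<bar> * (e (k + n) \<omega>)\<^sup>2)"
      using elim
      by (intro suminf_weighted_Cauchy_Schwarz(2) summable_ignore_initial_segment[OF a])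
         (auto simp: H_def summable_ignore_initial_segment[where f = "\<lambda>k. \<bar>a k\<bar> * (e k \<omega>)\<^sup>2"])
    also have "\<dots> = A n * (\<Sum>k. H (k + n) \<omega>)"
      by (simp add: A_def H_def)
    also have "\<dots> \<le> A n * (\<Sum>k. H k \<omega>)"
      using suminf_split_initial_segment[OF elim, of n] A_nonneg
      by (intro mult_left_mono) (auto simp: sum_nonneg H_nonneg)
    finally show ?case
      by simp
  qed
  have S: "square_integrable M (\<lambda>\<omega>. \<Sum>k<n. a k * e k \<omega>)" for n
    by (intro square_integrable_sum square_integrable_scale e)
  \<comment> \<open>For \<open>n = 0\<close> the partial sum is empty, so the tail estimate becomes
    a bound on \<open>Y^2\<close> itself.\<close>
  have "integrable M (\<lambda>\<omega>. (Y \<omega>)\<^sup>2)"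
  proof (rule Bochner_Integration.integrable_bound)
    show "integrable M (\<lambda>\<omega>. A 0 * (\<Sum>k. H k \<omega>))"
      using int_H by simp
    show "AE \<omega> in M. norm ((Y \<omega>)\<^sup>2) \<le> norm (A 0 * (\<Sum>k. H k \<omega>))"
      using tail[of 0] by eventually_elim simp
  qed simp
  then have Y_sq: "square_integrable M Y"
    by (simp add: square_integrable_def)
  have lim: "(\<lambda>n. \<integral>\<omega>. ((\<Sum>k<n. a k * e k \<omega>) - Y \<omega>)\<^sup>2 \<partial>M) \<longlonglongrightarrow> 0"
  proof (rule Lim_null_comparison)
    have "(\<lambda>n. suminf (\<lambda>k. \<bar>a k\<bar>) - (\<Sum>k<n. \<bar>a k\<bar>)) \<longlonglongrightarrow> suminf (\<lambda>k. \<bar>a k\<bar>) - suminf (\<lambda>k. \<bar>a k\<bar>)"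
      by (intro tendsto_intros summable_LIMSEQ a)
    then have "A \<longlonglongrightarrow> 0"
      by (simp add: A_def[abs_def] suminf_minus_initial_segment[OF a])
    then show "(\<lambda>n. A n * (\<integral>\<omega>. (\<Sum>k. H k \<omega>) \<partial>M)) \<longlonglongrightarrow> 0"
      by (rule tendsto_mult_left_zero)
    show "\<forall>\<^sub>F n in sequentially. norm (\<integral>\<omega>. ((\<Sum>k<n. a k * e k \<omega>) - Y \<omega>)\<^sup>2 \<partial>M)
        \<le> A n * (\<integral>\<omega>. (\<Sum>k. H k \<omega>) \<partial>M)"
    proof (rule always_eventually, rule allI)
      fix n
      have "(\<integral>\<omega>. ((\<Sum>k<n. a k * e k \<omega>) - Y \<omega>)\<^sup>2 \<partial>M) \<le> (\<integral>\<omega>. A n * (\<Sum>k. H k \<omega>) \<partial>M)"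
        using square_integrable_diff[OF S Y_sq] int_H tail[of n]
        by (intro integral_mono_AE) (auto simp: square_integrable_def)
      then show "norm (\<integral>\<omega>. ((\<Sum>k<n. a k * e k \<omega>) - Y \<omega>)\<^sup>2 \<partial>M)
          \<le> A n * (\<integral>\<omega>. (\<Sum>k. H k \<omega>) \<partial>M)"
        by simp
    qed
  qed
  show ?thesis
    using S Y_sq lim by (simp add: L2_tendsto_def Y_def)
qed

text \<open>Counting down from \<open>t\<close> by \<open>r = t - k\<close> turns the two-sided
  index set into a sequence, to which the previous lemma applies.\<close>

lemma has_L2_sum_weighted:
  fixes a :: "int \<Rightarrow> real"
  assumes a: "(\<lambda>r. \<bar>a r\<bar>) summable_on {..t}" and e: "\<And>r. square_integrable M (e r)"
    and B: "\<And>r. (\<integral>\<omega>. (e r \<omega>)\<^sup>2 \<partial>M) \<le> B"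
  shows "has_L2_sum M (\<lambda>r \<omega>. a r * e r \<omega>) t (\<lambda>\<omega>. \<Sum>k. a (t - int k) * e (t - int k) \<omega>)"
proof -
  have "(\<lambda>k. \<bar>a (t - int k)\<bar>) summable_on (UNIV :: nat set)"
    by (subst summable_on_reindex_bij_witness[where T = "{..t}" and i = "\<lambda>r. nat (t - r)"
          and j = "\<lambda>k. t - int k" and h = "\<lambda>r. \<bar>a r\<bar>"]) (auto simp: a)
  then have L: "L2_tendsto M (\<lambda>n \<omega>. \<Sum>k<n. a (t - int k) * e (t - int k) \<omega>)
      (\<lambda>\<omega>. \<Sum>k. a (t - int k) * e (t - int k) \<omega>) sequentially"
    by (intro L2_tendsto_weighted_sum[where B = B] e B summable_on_imp_summable)
  \<comment> \<open>The interval from \<open>s\<close> to \<open>t\<close> has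
    \<open>t + 1 - s\<close> elements. For \<open>s > t + 1\<close> the function \<open>nat\<close>
    truncates to 0, matching the empty interval.\<close>
  have sum_eq: "(\<Sum>k<nat (t + 1 - s). a (t - int k) * e (t - int k) \<omega>) = (\<Sum>r = s..t. a r * e r \<omega>)"
    for s \<omega>
    by (rule sum.reindex_bij_witness[where i = "\<lambda>r. nat (t - r)" and j = "\<lambda>k. t - int k"]) auto
  have lim: "filterlim (\<lambda>s. nat (t + 1 - s)) sequentially at_bot"
  proof (subst filterlim_at_top, intro allI)
    show "\<forall>\<^sub>F s in at_bot. n \<le> nat (t + 1 - s)" for n
      using eventually_le_at_bot[of "t + 1 - int n"] by eventually_elim linarith
  qed
  have "square_integrable M (\<lambda>\<omega>. \<Sum>r = s..t. a r * e r \<omega>)" for s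
    by (intro square_integrable_sum square_integrable_scale e)
  moreover from L have "((\<lambda>s. \<integral>\<omega>. ((\<Sum>r = s..t. a r * e r \<omega>)
      - (\<Sum>k. a (t - int k) * e (t - int k) \<omega>))\<^sup>2 \<partial>M) \<longlongrightarrow> 0) at_bot"
    unfolding L2_tendsto_def by (auto dest: filterlim_compose[OF _ lim] simp: sum_eq)
  ultimately show ?thesis
    using L by (simp add: has_L2_sum_def L2_tendsto_def)
qed

section \<open>Interval sums and orthogonality\<close>

text \<open>This links the two notions of summation: \<open>has_sum\<close> is a limit over all
  finite subsets, whereas \<open>has_L2_sum\<close> uses only intervals with lower end tending to
  minus infinity. Every finite subset of the half-line is eventually contained in such an
  interval.\<close>

lemma filterlim_atLeastAtMost_finite_subsets:
  "filterlim (\<lambda>s. {s..t}) (finite_subsets_at_top {..t}) (at_bot :: int filter)"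
  unfolding filterlim_finite_subsets_at_top
proof (intro allI impI)
  fix X :: "int set"
  assume X: "finite X \<and> X \<subseteq> {..t}"
  \<comment> \<open>Inserting \<open>t\<close> keeps the argument of \<open>Min\<close> nonempty
    when \<open>X\<close> is empty.\<close>
  show "\<forall>\<^sub>F s in at_bot. finite {s..t} \<and> X \<subseteq> {s..t} \<and> {s..t} \<subseteq> {..t}"
  proof (rule eventually_mono[OF eventually_le_at_bot[of "Min (insert t X)"]])
    fix s
    assume s: "s \<le> Min (insert t X)"
    have "s \<le> x" if "x \<in> X" for x
      using s that X Min_le[of "insert t X" x] by auto
    then show "finite {s..t} \<and> X \<subseteq> {s..t} \<and> {s..t} \<subseteq> {..t}"
      using X by auto
  qed
qed

text \<open>Orthogonality leaves only the indices common to both sums. The two index sets may differ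
  because partial sums for times \<open>t\<close> and \<open>t - l\<close> end at different points;
  the earlier one supplies \<open>J\<close>.\<close>

lemma integral_orthogonal_sums:
  assumes e: "\<And>r. square_integrable M (e r)"
    and orth: "\<And>r s. s \<noteq> r \<Longrightarrow> (\<integral>\<omega>. e r \<omega> * e s \<omega> \<partial>M) = 0"
    and "finite I" "J \<subseteq> I"
  shows "(\<integral>\<omega>. (\<Sum>r\<in>I. a r * e r \<omega>) * (\<Sum>r\<in>J. b r * e r \<omega>) \<partial>M)
    = (\<Sum>r\<in>J. a r * b r * (\<integral>\<omega>. (e r \<omega>)\<^sup>2 \<partial>M))"
proof -
  have J: "finite J"
    using assms finite_subset by blast
  have "(\<integral>\<omega>. (\<Sum>r\<in>I. a r * e r \<omega>) * (\<Sum>r\<in>J. b r * e r \<omega>) \<partial>M)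
      = (\<integral>\<omega>. (\<Sum>s\<in>J. \<Sum>r\<in>I. (a r * b s) * (e r \<omega> * e s \<omega>)) \<partial>M)"
    by (subst sum.swap) (simp add: sum_product algebra_simps)
  also have "\<dots> = (\<Sum>s\<in>J. \<Sum>r\<in>I. (a r * b s) * (\<integral>\<omega>. e r \<omega> * e s \<omega> \<partial>M))"
    using square_integrable_mult[OF e e] by simp
  also have "\<dots> = (\<Sum>s\<in>J. a s * b s * (\<integral>\<omega>. (e s \<omega>)\<^sup>2 \<partial>M))"
  proof (rule sum.cong[OF refl])
    fix s
    assume s: "s \<in> J"
    have "(\<Sum>r\<in>I. (a r * b s) * (\<integral>\<omega>. e r \<omega> * e s \<omega> \<partial>M))
        = (\<Sum>r\<in>I. if r = s then a s * b s * (\<integral>\<omega>. (e s \<omega>)\<^sup>2 \<partial>M) else 0)"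
      by (intro sum.cong) (auto simp: orth power2_eq_square)
    also have "\<dots> = a s * b s * (\<integral>\<omega>. (e s \<omega>)\<^sup>2 \<partial>M)"
      using s assms by auto
    finally show "(\<Sum>r\<in>I. (a r * b s) * (\<integral>\<omega>. e r \<omega> * e s \<omega> \<partial>M))
        = a s * b s * (\<integral>\<omega>. (e s \<omega>)\<^sup>2 \<partial>M)" .
  qed
  finally show ?thesis .
qed

section \<open>Absolute summability of the moving-average weights\<close>

lemma principal_det_eq_0: "t < s \<Longrightarrow> principal_det p \<phi> t s = 0"
  by (simp add: principal_det_def)

text \<open>Vanishing beyond \<open>t\<close> extends summability to all integers, after which any
  shift and any upper end \<open>u\<close> are allowed.\<close>

lemma summable_on_atMost_shift:
  fixes f :: "int \<Rightarrow> real"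
  assumes "f summable_on {..t}" "\<And>r. t < r \<Longrightarrow> f r = 0"
  shows "(\<lambda>r. f (r + k)) summable_on {..u}"
proof -
  have "f summable_on UNIV"
    using assms by (subst summable_on_cong_neutral[where T = "{..t}" and g = f]) auto
  then have "f summable_on {..u + k}"
    by (rule summable_on_subset) simp
  then show ?thesis
    by (subst summable_on_reindex_bij_witness[where T = "{..u + k}" and i = "\<lambda>r. r - k"
          and j = "\<lambda>r. r + k" and h = f]) auto
qed

text \<open>Each moving-average term is a shifted copy of the principal determinant times a bounded
  coefficient, so finitely many summable sequences dominate the weights.\<close>

lemma abs_summable_principal_det_ma:
  assumes "(\<lambda>r. \<bar>principal_det p \<phi> t r\<bar>) summable_on {..t}"
    and "\<And>l. l \<in> {1..q} \<Longrightarrow> bounded (range (\<theta> l))"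
  shows "(\<lambda>r. \<bar>principal_det_ma p q \<phi> \<theta> t r\<bar>) summable_on {..u}"
proof -
  have shift: "(\<lambda>r. \<bar>principal_det p \<phi> t (r + k)\<bar>) summable_on {..u}" for k
    by (rule summable_on_atMost_shift[OF assms(1)]) (simp add: principal_det_eq_0)
  have "\<exists>C. \<forall>r. \<bar>\<theta> l r\<bar> \<le> C" if "l \<in> {1..q}" for l
    using assms(2)[OF that] by (auto simp: bounded_iff)
  then obtain C where C: "\<And>l r. l \<in> {1..q} \<Longrightarrow> \<bar>\<theta> l r\<bar> \<le> C l"
    by metis
  \<comment> \<open>An arbitrary index set \<open>I\<close> replaces \<open>{1..q}\<close> so that
    set induction applies.\<close>
  have "(\<lambda>r. \<Sum>l\<in>I. \<bar>principal_det p \<phi> t (r + int l)\<bar> * C l) summable_on {..u}" for I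
    by (induction I rule: infinite_finite_induct)
       (auto intro!: summable_on_add summable_on_cmult_left[OF shift])
  then have "(\<lambda>r. \<bar>principal_det p \<phi> t r\<bar> + (\<Sum>l = 1..q. \<bar>principal_det p \<phi> t (r + int l)\<bar> * C l))
      summable_on {..u}"
    using shift[of 0] by (intro summable_on_add) auto
  then show ?thesis
  proof (rule summable_on_comparison_test)
    fix r
    have "\<bar>\<Sum>l = 1..q. principal_det p \<phi> t (r + int l) * \<theta> l (r + int l)\<bar>
        \<le> (\<Sum>l = 1..q. \<bar>principal_det p \<phi> t (r + int l)\<bar> * C l)"
      by (rule order_trans[OF sum_abs]) (auto intro!: sum_mono mult_left_mono C simp: abs_mult)
    then show "\<bar>principal_det_ma p q \<phi> \<theta> t r\<bar> \<le> \<bar>principal_det p \<phi> t r\<bar>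
        + (\<Sum>l = 1..q. \<bar>principal_det p \<phi> t (r + int l)\<bar> * C l)"
      unfolding principal_det_ma_def by linarith
  qed simp
qed

lemma abs_summable_on_mult_bounded:
  fixes f g :: "'i \<Rightarrow> real"
  assumes f: "(\<lambda>r. \<bar>f r\<bar>) summable_on A" and g: "\<And>r. r \<in> A \<Longrightarrow> \<bar>g r\<bar> \<le> C"
  shows "(\<lambda>r. f r * g r) summable_on A"
proof -
  have "(\<lambda>r. norm (f r * g r)) summable_on A"
    by (rule summable_on_comparison_test[OF summable_on_cmult_left[OF f, of C]])
       (auto simp: abs_mult intro!: mult_left_mono g)
  then show ?thesis
    by (rule abs_summable_summable)
qed

text \<open>A single term is at most the whole sum. In the covariance series this lets one of the
  two weight sequences serve as a bounded factor.\<close>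

lemma bounded_if_abs_summable_on:
  fixes f :: "'i \<Rightarrow> real"
  assumes "(\<lambda>r. \<bar>f r\<bar>) summable_on A"
  shows "\<exists>C. \<forall>r\<in>A. \<bar>f r\<bar> \<le> C"
proof (intro exI ballI)
  fix r
  assume "r \<in> A"
  then show "\<bar>f r\<bar> \<le> (\<Sum>\<^sub>\<infinity>r\<in>A. \<bar>f r\<bar>)"
    using finite_sum_le_infsum[OF assms, of "{r}"] by auto
qed

section \<open>Autocovariances of the represented process\<close>

theorem proposition4:
  fixes M :: "'a measure"
    and p q :: nat
    and \<phi>0 :: "int \<Rightarrow> real"
    and \<phi> \<theta> :: "nat \<Rightarrow> int \<Rightarrow> real"
    and \<sigma> :: "int \<Rightarrow> real"
    and y \<epsilon> :: "int \<Rightarrow> 'a \<Rightarrow> real"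
  assumes "prob_space M"
    and "p \<ge> 1" and "q \<ge> 1"
    and y_rv: "\<And>t. y t \<in> borel_measurable M"
    and eps_L2: "\<And>t. square_integrable M (\<epsilon> t)"
    and eps_mean: "\<And>t. (\<integral>\<omega>. \<epsilon> t \<omega> \<partial>M) = 0"
    and eps_uncorrelated: "\<And>t s. s \<noteq> t \<Longrightarrow> (\<integral>\<omega>. \<epsilon> t \<omega> * \<epsilon> s \<omega> \<partial>M) = 0"
    and eps_cond: "\<And>t. AE \<omega> in M. real_cond_exp M (strict_past M y t) (\<epsilon> t) \<omega> = 0"
    and eps_var: "\<And>t. (\<integral>\<omega>. (\<epsilon> t \<omega>)\<^sup>2 \<partial>M) = (\<sigma> t)\<^sup>2"
    and var_bounds: "\<exists>B. \<forall>t. 0 < (\<sigma> t)\<^sup>2 \<and> (\<sigma> t)\<^sup>2 \<le> B"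
    and arma: "\<And>t. AE \<omega> in M. y t \<omega> =
        \<phi>0 t + (\<Sum>m = 1..p. \<phi> m t * y (t - int m) \<omega>)
          + \<epsilon> t \<omega> + (\<Sum>l = 1..q. \<theta> l t * \<epsilon> (t - int l) \<omega>)"
    and abs_summable: "\<And>t. (\<lambda>r. \<bar>principal_det p \<phi> t r\<bar>) summable_on {..t}"
    and drift_bounded: "bounded (range \<phi>0)"
    and ma_bounded: "\<And>l. l \<in> {1..q} \<Longrightarrow> bounded (range (\<theta> l))"
    and y_repr: "\<And>t. AE \<omega> in M. y t \<omega> =
        (\<Sum>\<^sub>\<infinity>r\<in>{..t}. principal_det p \<phi> t r * \<phi>0 r)
          + L2_sum M (\<lambda>r \<omega>. principal_det_ma p q \<phi> \<theta> t r * \<epsilon> r \<omega>) t \<omega>"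
  shows "(\<forall>t. (\<lambda>r. principal_det p \<phi> t r * \<phi>0 r) summable_on {..t} \<and>
              L2_summable M (\<lambda>r \<omega>. principal_det_ma p q \<phi> \<theta> t r * \<epsilon> r \<omega>) t) \<and>
         (\<forall>t. \<forall>l::nat. \<exists>\<gamma>.
            has_covariance M (y t) (y (t - int l)) \<gamma> \<and>
            ((\<lambda>r. principal_det_ma p q \<phi> \<theta> t r *
                   principal_det_ma p q \<phi> \<theta> (t - int l) r * (\<sigma> r)\<^sup>2)
               has_sum \<gamma>) {..t - int l})"
proof -
  interpret prob_space M
    by fact
  define a where "a = principal_det_ma p q \<phi> \<theta>"
  define Z where "Z t = L2_sum M (\<lambda>r \<omega>. a t r * \<epsilon> r \<omega>) t" for t
  obtain B where B: "(\<sigma> t)\<^sup>2 \<le> B" for t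
    using var_bounds by blast
  obtain C where "\<bar>\<phi>0 r\<bar> \<le> C" for r
    using drift_bounded by (auto simp: bounded_iff)
  then have drift: "(\<lambda>r. principal_det p \<phi> t r * \<phi>0 r) summable_on {..t}" for t
    by (intro abs_summable_on_mult_bounded[OF abs_summable])
  have a: "(\<lambda>r. \<bar>a t r\<bar>) summable_on {..u}" for t u
    unfolding a_def by (rule abs_summable_principal_det_ma[OF abs_summable ma_bounded])
  have Z_ex: "L2_summable M (\<lambda>r \<omega>. a t r * \<epsilon> r \<omega>) t" for t
    using has_L2_sum_weighted[where e = \<epsilon> and B = B, OF a eps_L2, of t t] eps_var B
    by (auto simp: L2_summable_def)
  \<comment> \<open>The existence just shown makes the choice in \<open>L2_sum\<close> meaningful:
    the chosen version really is an \<open>L2\<close> limit. From here on only this property of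
    \<open>Z t\<close> is used.\<close>
  have Z: "L2_tendsto M (\<lambda>s \<omega>. \<Sum>r = s..t. a t r * \<epsilon> r \<omega>) (Z t) at_bot" for t
    using someI_ex[OF Z_ex[of t, unfolded L2_summable_def]]
    by (simp add: has_L2_sum_def Z_def L2_sum_def)
  have Z_L2: "square_integrable M (Z t)" for t
    using Z by (simp add: L2_tendsto_def)
  \<comment> \<open>The measure is finite, so constants are square-integrable. Multiplying by 1 then
    turns square-integrability into integrability.\<close>
  have one: "square_integrable M (\<lambda>_. 1)"
    by (simp add: square_integrable_def)
  have Z_int: "integrable M (Z t)" for t
    using square_integrable_mult[OF Z_L2 one] by simp
  have eps_int: "integrable M (\<epsilon> t)" for t
    using square_integrable_mult[OF eps_L2 one] by simp
  \<comment> \<open>The mean is the inner product with the constant 1, hence the limit of the means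
    of the partial sums, all of which are 0.\<close>
  have Z_mean: "(\<integral>\<omega>. Z t \<omega> \<partial>M) = 0" for t
  proof -
    have "L2_tendsto M (\<lambda>_ _. 1) (\<lambda>_. 1) (at_bot :: int filter)"
      using one by (simp add: L2_tendsto_def)
    from L2_tendsto_integral_mult[OF Z this]
    have "((\<lambda>s. \<integral>\<omega>. (\<Sum>r = s..t. a t r * \<epsilon> r \<omega>) \<partial>M) \<longlongrightarrow> (\<integral>\<omega>. Z t \<omega> \<partial>M)) at_bot"
      by simp
    moreover have "(\<integral>\<omega>. (\<Sum>r = s..t. a t r * \<epsilon> r \<omega>) \<partial>M) = 0" for s
      using eps_int by (simp add: eps_mean)
    ultimately show ?thesis
      by (simp add: tendsto_const_iff)
  qed
  \<comment> \<open>The series is first shown to have some sum \<open>S\<close>. Both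
    \<open>S\<close> and the integral are then limits of the same interval sums as \<open>s\<close>
    tends to minus infinity, so they agree.\<close>
  have Z_cov: "((\<lambda>r. a t r * a u r * (\<sigma> r)\<^sup>2) has_sum (\<integral>\<omega>. Z t \<omega> * Z u \<omega> \<partial>M)) {..u}"
    if "u \<le> t" for t u
  proof -
    obtain K where K: "\<And>r. r \<le> u \<Longrightarrow> \<bar>a u r\<bar> \<le> K"
      using bounded_if_abs_summable_on[OF a[of u u]] by auto
    have "\<bar>a u r * (\<sigma> r)\<^sup>2\<bar> \<le> K * B" if "r \<in> {..u}" for r
      using that mult_mono'[OF K B, of r r] by (simp add: abs_mult)
    then have "(\<lambda>r. a t r * (a u r * (\<sigma> r)\<^sup>2)) summable_on {..u}"
      by (rule abs_summable_on_mult_bounded[OF a])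
    then obtain S where S: "((\<lambda>r. a t r * a u r * (\<sigma> r)\<^sup>2) has_sum S) {..u}"
      by (auto simp: summable_on_def mult.assoc)
    then have "((\<lambda>s. \<Sum>r = s..u. a t r * a u r * (\<sigma> r)\<^sup>2) \<longlongrightarrow> S) at_bot"
      unfolding has_sum_def by (rule filterlim_compose[OF _ filterlim_atLeastAtMost_finite_subsets])
    \<comment> \<open>Both partial sums share the lower end \<open>s\<close>; with
      \<open>u <= t\<close> the second interval lies inside the first.\<close>
    moreover have "(\<integral>\<omega>. (\<Sum>r = s..t. a t r * \<epsilon> r \<omega>) * (\<Sum>r = s..u. a u r * \<epsilon> r \<omega>) \<partial>M)
        = (\<Sum>r = s..u. a t r * a u r * (\<sigma> r)\<^sup>2)" for s
      using that by (subst integral_orthogonal_sums[OF eps_L2 eps_uncorrelated]) (auto simp: eps_var)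
    ultimately have "S = (\<integral>\<omega>. Z t \<omega> * Z u \<omega> \<partial>M)"
      using L2_tendsto_integral_mult[OF Z[of t] Z[of u]]
      by (intro tendsto_unique[of at_bot]) auto
    with S show ?thesis
      by simp
  qed
  define \<mu> where "\<mu> t = (\<Sum>\<^sub>\<infinity>r\<in>{..t}. principal_det p \<phi> t r * \<phi>0 r)" for t
  have y_AE: "AE \<omega> in M. y t \<omega> = \<mu> t + Z t \<omega>" for t
    using y_repr[of t] by (simp add: \<mu>_def Z_def a_def)
  have [measurable]: "Z t \<in> borel_measurable M" "y t \<in> borel_measurable M" for t
    using Z_L2 y_rv by (auto simp: square_integrable_def)
  have y_int: "integrable M (y t)" for t
    using Z_int[of t] y_AE[of t]
    by (subst integrable_cong_AE[where g = "\<lambda>\<omega>. \<mu> t + Z t \<omega>"]) auto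
  have y_mean: "(\<integral>\<omega>. y t \<omega> \<partial>M) = \<mu> t" for t
  proof -
    have "(\<integral>\<omega>. y t \<omega> \<partial>M) = (\<integral>\<omega>. \<mu> t + Z t \<omega> \<partial>M)"
      using y_AE[of t] by (intro integral_cong_AE) auto
    then show ?thesis
      using Z_int by (simp add: Z_mean prob_space)
  qed
  \<comment> \<open>The deterministic part \<open>\<mu> t\<close> is exactly the mean of
    \<open>y t\<close>, so centring leaves \<open>Z t\<close> almost everywhere.\<close>
  have y_cov: "has_covariance M (y t) (y u) (\<integral>\<omega>. Z t \<omega> * Z u \<omega> \<partial>M)" for t u
  proof -
    have "AE \<omega> in M. (y t \<omega> - \<mu> t) * (y u \<omega> - \<mu> u) = Z t \<omega> * Z u \<omega>"
      using y_AE[of t] y_AE[of u] by eventually_elim simp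
    then have "has_bochner_integral M (\<lambda>\<omega>. (y t \<omega> - \<mu> t) * (y u \<omega> - \<mu> u))
        (\<integral>\<omega>. Z t \<omega> * Z u \<omega> \<partial>M)"
      using has_bochner_integral_integrable[OF square_integrable_mult[OF Z_L2 Z_L2]]
      by (subst has_bochner_integral_cong_AE[where g = "\<lambda>\<omega>. Z t \<omega> * Z u \<omega>"]) auto
    then show ?thesis
      by (simp add: has_covariance_def y_int y_mean)
  qed
  show ?thesis
    unfolding a_def[symmetric]
    \<comment> \<open>\<open>Z_cov\<close> is applied with \<open>u = t - l\<close>; the last
      \<open>simp\<close> discharges \<open>u <= t\<close>, which holds since \<open>l\<close> is a
      natural number.\<close>
    by (intro conjI allI drift Z_ex, intro exI conjI, rule y_cov, rule Z_cov, simp)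
qed

end
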